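(* Let $A$ be a left brace of cardinality $p_1^{\alpha_1}\cdots p_n^{\alpha_n}$ for some pairwise distinct prime numbers $p_1,\ldots,p_n$ and some positive integers $\alpha_1,\ldots,\alpha_n$. Assume that for every $i\le n$ and every $k<i$, $p_i$ does not divide $p_k^t-1$ for any $1\le t\le\alpha_k$. If all the Sylow subgroups of the additive group of $A$ (which are left braces under the operations of $A$) are braces of a finite multipermutation level, then $A$ is a brace of a finite multipermutation level.
   Context: A left brace is an abelian group $(A,+)$ with a multiplication $\cdot$ such that $a\cdot(b+c)=a\cdot b+a\cdot c$ for all $a,b,c\in A$ and such that the circle operation $a\circ b=a\cdot b+a+b$ makes $A$ into a group (with identity $0$). Put $A^{(1)}=A$ and let $A^{(n)}=A^{(n-1)}\cdot A$ be the additive subgroup generated by all $x\cdot a$ with $x\in A^{(n-1)}$, $a\in A$; a left brace $A$ has a finite multipermutation level if $A^{(n)}=0$ for some $n$. If $A$ is a finite left brace, every Sylow subgroup of its additive group is a left brace under the operations of $A$. *)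

theory Defs
  imports "HOL-Algebra.Algebra" "HOL-Computational_Algebra.Primes"
begin

text \<open>
  Braces are carried by the \<^type>\<open>ring_ext\<close> record so that the library's \<^locale>\<open>abelian_group\<close>
  applies to the additive structure. The field \<^const>\<open>monoid.one\<close> plays no role: a brace need not have
  a unit for its multiplication, and the identity of the circle group is the additive zero.
\<close>

definition circle_group :: "('a, 'm) ring_scheme \<Rightarrow> 'a monoid" where
  "circle_group A =
     \<lparr>carrier = carrier A,
      monoid.mult = (\<lambda>a b. (a \<otimes>\<^bsub>A\<^esub> b) \<oplus>\<^bsub>A\<^esub> a \<oplus>\<^bsub>A\<^esub> b),
      monoid.one = \<zero>\<^bsub>A\<^esub>\<rparr>"

locale left_brace = abelian_group A for A :: "('a, 'm) ring_scheme" (structure) +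
  assumes mult_closed: "\<lbrakk>a \<in> carrier A; b \<in> carrier A\<rbrakk> \<Longrightarrow> a \<otimes> b \<in> carrier A"
    and left_distrib:
      "\<lbrakk>a \<in> carrier A; b \<in> carrier A; c \<in> carrier A\<rbrakk> \<Longrightarrow> a \<otimes> (b \<oplus> c) = a \<otimes> b \<oplus> a \<otimes> c"
    and group_circle: "group (circle_group A)"

definition brace_prod :: "('a, 'm) ring_scheme \<Rightarrow> 'a set \<Rightarrow> 'a set \<Rightarrow> 'a set" where
  "brace_prod A U V = generate (add_monoid A) {x \<otimes>\<^bsub>A\<^esub> y | x y. x \<in> U \<and> y \<in> V}"

text \<open>The series \<open>A\<^sup>(\<^sup>n\<^sup>)\<close> starts at \<open>n = 1\<close>; the value at \<open>0\<close> is a dummy.\<close>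

fun right_series :: "('a, 'm) ring_scheme \<Rightarrow> nat \<Rightarrow> 'a set" where
  "right_series A 0 = carrier A"
| "right_series A (Suc 0) = carrier A"
| "right_series A (Suc (Suc n)) = brace_prod A (right_series A (Suc n)) (carrier A)"

definition finite_multipermutation_level :: "('a, 'm) ring_scheme \<Rightarrow> bool" where
  "finite_multipermutation_level A \<longleftrightarrow> (\<exists>n\<ge>1. right_series A n = {\<zero>\<^bsub>A\<^esub>})"

text \<open>Intended for finite \<open>G\<close>; for a prime not dividing the order this is the trivial subgroup.\<close>

definition sylow_subgroup :: "nat \<Rightarrow> 'a set \<Rightarrow> ('a, 'm) monoid_scheme \<Rightarrow> bool" where
  "sylow_subgroup p H G \<longleftrightarrow>
     Factorial_Ring.prime p \<and> subgroup H G \<and> card H = p ^ multiplicity p (order G)"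

end

theory Submission
  imports Defs
begin

text \<open>
  Write \<open>A\<^sub>i\<close> for the Sylow \<open>p\<^sub>i\<close>-subgroup of the additive group; it is invariant under all maps
  \<open>\<lambda>\<^sub>a(b) = a \<cdot> b + b\<close>. For \<open>k < i\<close> the \<open>p\<^sub>i\<close>-group \<open>(A\<^sub>i, \<circ>)\<close> acts through \<open>\<lambda>\<close> on \<open>A\<^sub>k\<close>, and its fixed points
  form a subgroup of order \<open>p\<^sub>k\<^sup>s\<close> with \<open>p\<^sub>k\<^sup>s \<equiv> p\<^sub>k\<^sup>\<alpha>\<close> modulo \<open>p\<^sub>i\<close>, where \<open>\<alpha> = \<alpha>\<^sub>k\<close>. The hypothesis on
  \<open>p\<^sub>k\<^sup>t - 1\<close> forces \<open>s = \<alpha>\<close>, so \<open>A\<^sub>i \<cdot> A\<^sub>k = 0\<close>.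

  It suffices that every brace \<open>A / I \<noteq> 0\<close> has a nonzero socle. Take the largest \<open>i\<close> with \<open>A\<^sub>i\<close> not
  contained in \<open>I\<close>, and an element \<open>a\<close> outside \<open>I\<close> of the last term of the series of \<open>A\<^sub>i\<close> not contained
  in \<open>I\<close>. Then \<open>a \<cdot> A\<^sub>k\<close> lies in \<open>I\<close> for all \<open>k\<close>: for \<open>k < i\<close> by the above, for \<open>k = i\<close> by the choice of
  \<open>a\<close>, and for \<open>k > i\<close> because \<open>A\<^sub>k\<close> is contained in \<open>I\<close>. Hence \<open>a\<close> represents a nonzero element of the socle.
\<close>

section \<open>Fixed points of p-groups acting on q-groups\<close>

text \<open>Orbit sizes divide \<open>p ^ m\<close>. An orbit containing a fixed point is a
  singleton; every other orbit has more than one element, so \<open>p\<close> divides its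
  size.\<close>

lemma (in group_action) card_fixed_points_mod:
  assumes p: "Factorial_Ring.prime p" and order: "order G = p ^ m" and fin: "finite E"
  shows "card E mod p = card {x \<in> E. \<forall>g\<in>carrier G. \<phi> g x = x} mod p"
proof -
  interpret group G
    using group_hom group_hom.axioms(1) by auto
  let ?F = "{x \<in> E. \<forall>g\<in>carrier G. \<phi> g x = x}"
  let ?O = "orbits G E \<phi>"
  have fin_orb: "finite B" "B \<subseteq> E" if "B \<in> ?O" for B
    using that orbits_coverture fin by (auto intro: finite_subset)
  have orb_E: "E = \<Union> ?O" by (simp add: orbits_coverture)
  have fin_O: "finite ?O"
    unfolding orbits_def using fin by simp
  have "card B mod p = card (B \<inter> ?F) mod p" if B: "B \<in> ?O" for B
  proof -
    obtain x where x: "x \<in> E" "B = orbit G \<phi> x"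
      using B by (auto simp: orbits_def)
    have dvd: "card B dvd p ^ m"
      using orbit_stabilizer_theorem[OF x(1)] order x(2) by (metis dvd_triv_left)
    show ?thesis
    proof (cases "B \<inter> ?F = {}")
      case True
      have "card B \<noteq> 1"
      proof
        assume "card B = 1"
        then have "B = {x}"
          using orbit_refl[OF x(1)] x(2) by (metis card_1_singletonE singletonD)
        then have "x \<in> B \<inter> ?F"
          using x by (auto simp: orbit_def)
        with True show False by blast
      qed
      with dvd p have "p dvd card B"
        by (metis divides_primepow_nat dvd_power less_numeral_extra(3) neq0_conv power_0)
      with True show ?thesis
        by simp
    next
      case False
      then obtain y where y: "y \<in> B" "y \<in> ?F" by blast
      have "x \<in> orbit G \<phi> y"
        using y x by (auto intro: orbit_sym)
      then have "x = y"
        using y by (auto simp: orbit_def)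
      then have "B = {y}"
        using x y by (auto simp: orbit_def intro: exI[of _ \<one>])
      with y show ?thesis by simp
    qed
  qed
  then have "(\<Sum>B\<in>?O. card B) mod p = (\<Sum>B\<in>?O. card (B \<inter> ?F)) mod p"
    by (subst (1 2) mod_sum_eq[symmetric]) simp
  moreover have "card E = (\<Sum>B\<in>?O. card B)"
    using disjoint_sum[OF fin, of "\<lambda>_. 1 :: nat"] by simp
  moreover have "card ?F = (\<Sum>B\<in>?O. card (B \<inter> ?F))"
  proof -
    have "card ?F = card (\<Union>B\<in>?O. B \<inter> ?F)"
      using orb_E by (intro arg_cong[where f = card]) blast
    also have "\<dots> = (\<Sum>B\<in>?O. card (B \<inter> ?F))"
      using fin_O fin_orb disjoint_union by (intro card_UN_disjoint) blast+
    finally show ?thesis .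
  qed
  ultimately show ?thesis by simp
qed

text \<open>Because the action is by endomorphisms of \<open>M\<close>, Lagrange allows only powers
  of \<open>q\<close> as the number of fixed points, and the congruence modulo \<open>p\<close> then
  leaves only \<open>q ^ \<alpha>\<close>.\<close>

lemma (in group_action) p_group_acts_trivially:
  assumes p: "Factorial_Ring.prime p" and order: "order G = p ^ m"
    and q: "Factorial_Ring.prime q" and neq: "p \<noteq> q"
    and M: "group M" and E: "carrier M = E" "card E = q ^ \<alpha>"
    and hom: "\<And>g. g \<in> carrier G \<Longrightarrow> \<phi> g \<in> hom M M"
    and not_dvd: "\<And>t. 1 \<le> t \<Longrightarrow> t \<le> \<alpha> \<Longrightarrow> \<not> p dvd q ^ t - 1"
    and g: "g \<in> carrier G" and x: "x \<in> E"
  shows "\<phi> g x = x"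
proof -
  interpret M: group M by (rule M)
  let ?F = "{x \<in> E. \<forall>g\<in>carrier G. \<phi> g x = x}"
  have fin: "finite E"
    using E(2) q by (metis card_ge_0_finite prime_gt_0_nat zero_less_power)
  have hom': "group_hom M M (\<phi> g)" if "g \<in> carrier G" for g
    using hom[OF that] by (simp add: group_hom.intro group_hom_axioms.intro M.group_axioms)
  have "subgroup ?F M"
  proof (rule M.subgroupI)
    show "?F \<noteq> {}"
      using E(1) hom' by (auto intro!: exI[of _ "\<one>\<^bsub>M\<^esub>"] simp: group_hom.hom_one)
  next
    fix a assume "a \<in> ?F"
    then show "inv\<^bsub>M\<^esub> a \<in> ?F"
      using E(1) hom' group_hom.hom_inv by fastforce
  next
    fix a b assume "a \<in> ?F" "b \<in> ?F"
    then show "a \<otimes>\<^bsub>M\<^esub> b \<in> ?F"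
      using E(1) by (auto simp: hom_mult[OF hom])
  qed (use E(1) in auto)
  from M.lagrange[OF this] have "card ?F dvd q ^ \<alpha>"
    unfolding order_def E by (rule dvdI[OF trans[OF sym mult.commute]])
  then have "\<exists>s\<le>\<alpha>. card ?F = q ^ s"
    by (simp only: divides_primepow_nat[OF q])
  then obtain s where s: "s \<le> \<alpha>" "card ?F = q ^ s"
    by (elim exE conjE)
  have "s = \<alpha>"
  proof (rule ccontr)
    assume "s \<noteq> \<alpha>"
    have "q ^ \<alpha> mod p = q ^ s mod p"
      using card_fixed_points_mod[OF p order fin] E(2) s(2) by simp
    then have "p dvd q ^ \<alpha> - q ^ s"
      by (rule mod_eq_dvd_iff_nat[THEN iffD1, rotated]) (rule power_increasing[OF s(1) prime_ge_1_nat[OF q]])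
    \<comment> \<open>The prime \<open>p\<close> differs from \<open>q\<close>, so it must divide
      the second factor, whose exponent lies between 1 and \<open>\<alpha>\<close>.\<close>
    moreover have "q ^ \<alpha> - q ^ s = q ^ s * (q ^ (\<alpha> - s) - 1)"
      using s(1) by (simp add: diff_mult_distrib2 flip: power_add)
    ultimately have "p dvd q ^ (\<alpha> - s) - 1"
      using p q neq by (metis prime_dvd_mult_iff prime_dvd_power primes_dvd_imp_eq)
    then show False
      using not_dvd[of "\<alpha> - s"] \<open>s \<noteq> \<alpha>\<close> s(1) by linarith
  qed
  then have "?F = E"
    using s(2) E(2) fin by (intro card_subset_eq) auto
  with g x show ?thesis by blast
qed

section \<open>Subgroups whose order and index are coprime\<close>

text \<open>The order of the coset of \<open>x\<close> in the quotient divides both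
  \<open>card H\<close> and the index, hence is 1.\<close>

lemma (in comm_group) coprime_index_mem:
  assumes H: "subgroup H G" and cop: "coprime (card H) (card (rcosets H))"
    and x: "x \<in> carrier G" "x [^] card H = \<one>"
  shows "x \<in> H"
proof -
  interpret H: normal H G
    using H by (rule subgroup_imp_normal)
  interpret Q: group "G Mod H" by (rule H.factorgroup_is_group)
  have hom: "group_hom G (G Mod H) ((#>) H)"
    by (intro group_hom.intro group_hom_axioms.intro group_axioms H.factorgroup_is_group
        H.r_coset_hom_Mod)
  have Hx: "H #> x \<in> carrier (G Mod H)"
    by (rule group_hom.hom_closed[OF hom x(1)])
  have "(H #> x) [^]\<^bsub>G Mod H\<^esub> card H = \<one>\<^bsub>G Mod H\<^esub>"
    using group_hom.hom_nat_pow[OF hom x(1), of "card H", symmetric] group_hom.hom_one[OF hom]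
    by (simp only: x(2))
  moreover have "(H #> x) [^]\<^bsub>G Mod H\<^esub> card (rcosets H) = \<one>\<^bsub>G Mod H\<^esub>"
    using Q.pow_order_eq_1[OF Hx] by (simp add: order_def FactGroup_def)
  ultimately have "Q.ord (H #> x) dvd card H" "Q.ord (H #> x) dvd card (rcosets H)"
    using Hx Q.pow_eq_id by blast+
  then have "Q.ord (H #> x) = 1"
    using cop by (metis coprime_common_divisor nat_dvd_1_iff_1)
  then have "H #> x = \<one>\<^bsub>G Mod H\<^esub>"
    using Hx Q.ord_eq_1 by blast
  then show ?thesis
    using rcos_self[OF x(1) H] by (simp add: one_FactGroup)
qed

text \<open>Endomorphisms preserve the equation \<open>x [^] card H = \<one>\<close>, which
  characterizes \<open>H\<close>.\<close>

lemma (in comm_group) coprime_index_invariant: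
  assumes H: "subgroup H G" and cop: "coprime (card H) (card (rcosets H))"
    and f: "f \<in> hom G G" and x: "x \<in> H"
  shows "f x \<in> H"
proof (rule coprime_index_mem[OF H cop])
  have f': "group_hom G G f"
    using f by (simp add: group_hom.intro group_hom_axioms.intro group_axioms)
  interpret H: subgroup H G by (rule H)
  have xG: "x \<in> carrier G" using x H.subset by auto
  show "f x \<in> carrier G" using f xG by (auto simp: hom_def)
  interpret S: group "G\<lparr>carrier := H\<rparr>" by (rule H.subgroup_is_group) (rule group_axioms)
  have "x [^] card H = \<one>"
    using S.pow_order_eq_1[of x] x by (simp add: order_def nat_pow_consistent[symmetric])
  then show "f x [^] card H = \<one>"
    using group_hom.hom_nat_pow[OF f' xG, of "card H"] group_hom.hom_one[OF f'] by simp
qed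

section \<open>Arithmetic of a left brace\<close>

context left_brace
begin

definition circ :: "'a \<Rightarrow> 'a \<Rightarrow> 'a" where
  "circ a b = a \<otimes> b \<oplus> a \<oplus> b"

abbreviation circ_inv :: "'a \<Rightarrow> 'a" where
  "circ_inv a \<equiv> inv\<^bsub>circle_group A\<^esub> a"

definition lam :: "'a \<Rightarrow> 'a \<Rightarrow> 'a" where
  "lam a b = a \<otimes> b \<oplus> b"

lemma circle_group_simps:
  "carrier (circle_group A) = carrier A" "a \<otimes>\<^bsub>circle_group A\<^esub> b = circ a b"
  "\<one>\<^bsub>circle_group A\<^esub> = \<zero>"
  by (simp_all add: circle_group_def circ_def)

lemma circ_closed: "a \<in> carrier A \<Longrightarrow> b \<in> carrier A \<Longrightarrow> circ a b \<in> carrier A"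
  by (simp add: circ_def mult_closed)

lemma circ_assoc:
  assumes "a \<in> carrier A" "b \<in> carrier A" "c \<in> carrier A"
  shows "circ (circ a b) c = circ a (circ b c)"
  using monoid.m_assoc[OF group.is_monoid[OF group_circle], of a b c] assms
  by (simp add: circle_group_simps)

lemma circ_inv:
  assumes "a \<in> carrier A"
  shows "circ_inv a \<in> carrier A" "circ (circ_inv a) a = \<zero>" "circ a (circ_inv a) = \<zero>"
  using group.inv_closed[OF group_circle, of a] group.l_inv[OF group_circle, of a]
    group.r_inv[OF group_circle, of a] assms
  by (simp_all add: circle_group_simps)

lemma circ_zero: "a \<in> carrier A \<Longrightarrow> circ \<zero> a = a"
  using monoid.l_one[OF group.is_monoid[OF group_circle], of a] by (simp add: circle_group_simps)

lemma zero_mult: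
  assumes a: "a \<in> carrier A"
  shows "\<zero> \<otimes> a = \<zero>"
proof -
  have "\<zero> \<otimes> a \<oplus> a = a"
    using circ_zero[OF a] a by (simp add: circ_def mult_closed)
  then show ?thesis
    using a mult_closed[of \<zero> a] by (metis add.r_cancel_one' zero_closed)
qed

lemma mult_zero:
  assumes a: "a \<in> carrier A"
  shows "a \<otimes> \<zero> = \<zero>"
  using left_distrib[of a \<zero> \<zero>] a mult_closed[of a \<zero>] by simp

lemma mult_minus:
  assumes a: "a \<in> carrier A" "b \<in> carrier A"
  shows "a \<otimes> (\<ominus> b) = \<ominus> (a \<otimes> b)"
  using left_distrib[of a b "\<ominus> b"] a mult_closed mult_zero
  by (metis a_inv_closed minus_equality a_comm r_neg)

text \<open>Associativity of the circle operation, expanded by left distributivity. It serves as the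
  substitute for right distributivity.\<close>

lemma circ_mult:
  assumes c: "a \<in> carrier A" "b \<in> carrier A" "c \<in> carrier A"
  shows "circ a b \<otimes> c = a \<otimes> (b \<otimes> c) \<oplus> a \<otimes> c \<oplus> b \<otimes> c"
proof -
  have cl: "a \<otimes> b \<in> carrier A" "a \<otimes> c \<in> carrier A" "b \<otimes> c \<in> carrier A"
    "a \<otimes> (b \<otimes> c) \<in> carrier A" "circ a b \<otimes> c \<in> carrier A" "circ a b \<in> carrier A"
    using c by (simp_all add: mult_closed circ_closed)
  have "circ a b \<otimes> c \<oplus> circ a b \<oplus> c = a \<otimes> (b \<otimes> c \<oplus> b \<oplus> c) \<oplus> a \<oplus> (b \<otimes> c \<oplus> b \<oplus> c)"
    using circ_assoc[OF c] by (simp add: circ_def)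
  also have "\<dots> = (a \<otimes> (b \<otimes> c) \<oplus> a \<otimes> c \<oplus> b \<otimes> c) \<oplus> circ a b \<oplus> c"
    using c cl by (simp add: circ_def left_distrib a_ac)
  finally show ?thesis
    using c cl by (simp add: add.r_cancel)
qed

lemma lam_closed: "a \<in> carrier A \<Longrightarrow> b \<in> carrier A \<Longrightarrow> lam a b \<in> carrier A"
  by (simp add: lam_def mult_closed)

lemma lam_zero: "b \<in> carrier A \<Longrightarrow> lam \<zero> b = b"
  by (simp add: lam_def zero_mult)

lemma lam_circ:
  assumes "a \<in> carrier A" "b \<in> carrier A" "c \<in> carrier A"
  shows "lam (circ a b) c = lam a (lam b c)"
  using assms by (simp add: lam_def circ_mult mult_closed left_distrib a_ac)

lemma lam_hom: "a \<in> carrier A \<Longrightarrow> lam a \<in> hom (add_monoid A) (add_monoid A)"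
  by (simp add: hom_def Pi_def lam_closed) (simp add: lam_def mult_closed left_distrib a_ac)

lemma lam_circ_inv:
  assumes "a \<in> carrier A" "b \<in> carrier A"
  shows "lam a (lam (circ_inv a) b) = b" "lam (circ_inv a) (lam a b) = b"
  using assms by (simp_all add: circ_inv lam_zero flip: lam_circ)

lemma circ_eq_add_lam: "a \<in> carrier A \<Longrightarrow> b \<in> carrier A \<Longrightarrow> circ a b = a \<oplus> lam a b"
  by (simp add: circ_def lam_def mult_closed a_ac)

text \<open>Turns a sum in the left factor of a product into a circle product, so that
  \<open>circ_mult\<close> applies.\<close>

lemma add_eq_circ:
  "a \<in> carrier A \<Longrightarrow> b \<in> carrier A \<Longrightarrow> a \<oplus> b = circ a (lam (circ_inv a) b)"
  by (simp add: circ_eq_add_lam lam_closed circ_inv lam_circ_inv)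

section \<open>Ideals and socles of quotients\<close>

text \<open>Ideals of braces are usually required to be normal in the circle group; for a left ideal \<open>I\<close>
  this is equivalent to \<open>I \<cdot> A \<subseteq> I\<close>.\<close>

definition brace_ideal :: "'a set \<Rightarrow> bool" where
  "brace_ideal I \<longleftrightarrow> subgroup I (add_monoid A) \<and>
     (\<forall>a\<in>carrier A. \<forall>x\<in>I. a \<otimes> x \<in> I \<and> x \<otimes> a \<in> I)"

text \<open>The preimage in \<open>A\<close> of the socle of the quotient brace \<open>A / I\<close>.\<close>

definition socle_mod :: "'a set \<Rightarrow> 'a set" where
  "socle_mod I = {a \<in> carrier A. \<forall>b\<in>carrier A. a \<otimes> b \<in> I}"

lemma brace_idealD:
  assumes "brace_ideal I"
  shows "x \<in> I \<Longrightarrow> x \<in> carrier A" "\<zero> \<in> I" "x \<in> I \<Longrightarrow> y \<in> I \<Longrightarrow> x \<oplus> y \<in> I"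
    "x \<in> I \<Longrightarrow> \<ominus> x \<in> I" "a \<in> carrier A \<Longrightarrow> x \<in> I \<Longrightarrow> a \<otimes> x \<in> I"
    "a \<in> carrier A \<Longrightarrow> x \<in> I \<Longrightarrow> x \<otimes> a \<in> I"
  using assms subgroup.mem_carrier[of I "add_monoid A"] subgroup.one_closed[of I "add_monoid A"]
    subgroup.m_closed[of I "add_monoid A"] subgroup.m_inv_closed[of I "add_monoid A"]
  by (auto simp: brace_ideal_def a_inv_def)

lemma brace_ideal_zero: "brace_ideal {\<zero>}"
  using add.triv_subgroup by (simp add: brace_ideal_def mult_zero zero_mult)

lemma brace_ideal_add_mem_iff:
  assumes I: "brace_ideal I" and x: "x \<in> I" and y: "y \<in> carrier A"
  shows "x \<oplus> y \<in> I \<longleftrightarrow> y \<in> I"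
proof
  have xA: "x \<in> carrier A" using brace_idealD(1)[OF I x] .
  assume "x \<oplus> y \<in> I"
  then have "\<ominus> x \<oplus> (x \<oplus> y) \<in> I"
    using brace_idealD[OF I] x by blast
  then show "y \<in> I"
    using xA y by (simp add: r_neg1)
qed (use brace_idealD[OF I] x in blast)

text \<open>Since \<open>x \<oplus> i\<close> equals \<open>circ x ?j\<close> with \<open>?j\<close>
  in \<open>I\<close>, \<open>circ_mult\<close> shows that the two products differ by an element of
  \<open>I\<close>.\<close>

lemma add_mult_cong:
  assumes I: "brace_ideal I" and x: "x \<in> carrier A" and i: "i \<in> I" and c: "c \<in> carrier A"
  shows "(x \<oplus> i) \<otimes> c \<in> I \<longleftrightarrow> x \<otimes> c \<in> I"
proof -
  note D = brace_idealD[OF I]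
  let ?j = "lam (circ_inv x) i"
  have j: "?j \<in> I"
    using D x i circ_inv by (simp add: lam_def)
  have jA: "?j \<in> carrier A" using D(1) j .
  have "(x \<oplus> i) \<otimes> c = x \<otimes> (?j \<otimes> c) \<oplus> x \<otimes> c \<oplus> ?j \<otimes> c"
    using x i c D(1) jA by (simp add: add_eq_circ circ_mult)
  also have "\<dots> = (x \<otimes> (?j \<otimes> c) \<oplus> ?j \<otimes> c) \<oplus> x \<otimes> c"
    using x c jA by (simp add: mult_closed a_ac)
  finally show ?thesis
    using brace_ideal_add_mem_iff[OF I, of "x \<otimes> (?j \<otimes> c) \<oplus> ?j \<otimes> c" "x \<otimes> c"] D j x c
    by (simp add: mult_closed)
qed

lemma subset_socle_mod: "brace_ideal I \<Longrightarrow> I \<subseteq> socle_mod I"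
  using brace_idealD by (auto simp: socle_mod_def)

lemma socle_mod_add_ideal:
  assumes "brace_ideal I" "a \<in> socle_mod I" "i \<in> I"
  shows "a \<oplus> i \<in> socle_mod I"
  using assms add_mult_cong brace_idealD(1) by (auto simp: socle_mod_def)

text \<open>\<open>socle_mod I\<close> is the kernel of the action of the circle group on
  \<open>A / I\<close> through \<open>lam\<close>, hence a normal subgroup of the circle group. This
  lemma and the next two check that by \<open>circ_mult\<close>.\<close>

lemma socle_mod_circ:
  assumes I: "brace_ideal I" and a: "a \<in> socle_mod I" and b: "b \<in> socle_mod I"
  shows "circ a b \<in> socle_mod I"
  using a b brace_idealD[OF I]
  by (auto simp: socle_mod_def circ_closed circ_mult)

lemma socle_mod_circ_inv:
  assumes I: "brace_ideal I" and a: "a \<in> socle_mod I"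
  shows "circ_inv a \<in> socle_mod I"
proof -
  note D = brace_idealD[OF I]
  have aA: "a \<in> carrier A" "circ_inv a \<in> carrier A"
    using a circ_inv by (auto simp: socle_mod_def)
  have "circ_inv a \<otimes> c \<in> I" if c: "c \<in> carrier A" for c
  proof -
    have ac: "a \<otimes> c \<in> I" using a c by (simp add: socle_mod_def)
    \<comment> \<open>This expands \<open>circ (circ_inv a) a \<otimes> c\<close>; all summands
      except \<open>circ_inv a \<otimes> c\<close> are known to lie in \<open>I\<close>.\<close>
    have "\<zero> = circ_inv a \<otimes> (a \<otimes> c) \<oplus> circ_inv a \<otimes> c \<oplus> a \<otimes> c"
      using circ_mult[OF aA(2,1) c] aA c by (simp add: circ_inv zero_mult)
    also have "\<dots> = (circ_inv a \<otimes> (a \<otimes> c) \<oplus> a \<otimes> c) \<oplus> circ_inv a \<otimes> c"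
      using aA c by (simp add: mult_closed a_ac)
    finally show ?thesis
      using brace_ideal_add_mem_iff[OF I, of "circ_inv a \<otimes> (a \<otimes> c) \<oplus> a \<otimes> c" "circ_inv a \<otimes> c"]
        D ac aA c by (simp add: mult_closed)
  qed
  with aA show ?thesis by (simp add: socle_mod_def)
qed

lemma socle_mod_conj:
  assumes I: "brace_ideal I" and a: "a \<in> socle_mod I" and c: "c \<in> carrier A"
  shows "circ (circ c a) (circ_inv c) \<in> socle_mod I"
proof -
  note D = brace_idealD[OF I]
  have aA: "a \<in> carrier A" "circ_inv c \<in> carrier A"
    using a c circ_inv by (auto simp: socle_mod_def)
  have "circ (circ c a) (circ_inv c) \<otimes> b \<in> I" if b: "b \<in> carrier A" for b
  proof -
    let ?d = "circ_inv c \<otimes> b"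
    have d: "?d \<in> carrier A" using aA b by (simp add: mult_closed)
    have ad: "a \<otimes> ?d \<in> I" "a \<otimes> b \<in> I"
      using a b d by (auto simp: socle_mod_def)
    \<comment> \<open>The expansion of \<open>circ c (circ_inv c) \<otimes> b\<close>. It cancels
      exactly the three summands below that do not contain \<open>a\<close>.\<close>
    have 0: "\<zero> = c \<otimes> ?d \<oplus> c \<otimes> b \<oplus> ?d"
      using circ_mult[OF c aA(2) b] b c by (simp add: circ_inv zero_mult)
    have "circ (circ c a) (circ_inv c) \<otimes> b
        = (c \<otimes> (a \<otimes> ?d) \<oplus> c \<otimes> ?d \<oplus> a \<otimes> ?d) \<oplus> (c \<otimes> (a \<otimes> b) \<oplus> c \<otimes> b \<oplus> a \<otimes> b) \<oplus> ?d"
      using aA b c d by (simp add: circ_mult circ_closed)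
    also have "\<dots> = (c \<otimes> ?d \<oplus> c \<otimes> b \<oplus> ?d)
        \<oplus> (c \<otimes> (a \<otimes> ?d) \<oplus> a \<otimes> ?d \<oplus> c \<otimes> (a \<otimes> b) \<oplus> a \<otimes> b)"
      using aA b c d by (simp add: mult_closed a_ac)
    also have "\<dots> = c \<otimes> (a \<otimes> ?d) \<oplus> a \<otimes> ?d \<oplus> c \<otimes> (a \<otimes> b) \<oplus> a \<otimes> b"
      unfolding 0[symmetric] using aA b c d by (simp add: mult_closed)
    also have "\<dots> \<in> I"
      using D ad c by simp
    finally show ?thesis .
  qed
  with aA c show ?thesis by (simp add: socle_mod_def circ_closed)
qed

text \<open>The conjugate \<open>a'\<close> satisfies \<open>circ a' c = circ c a\<close>. Writing
  both sides as sums and cancelling \<open>c\<close> shows that \<open>lam c a\<close> and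
  \<open>a'\<close> differ by \<open>a' \<otimes> c\<close>, an element of \<open>I\<close>.\<close>

lemma socle_mod_lam:
  assumes I: "brace_ideal I" and a: "a \<in> socle_mod I" and c: "c \<in> carrier A"
  shows "lam c a \<in> socle_mod I"
proof -
  define a' where "a' = circ (circ c a) (circ_inv c)"
  have a': "a' \<in> socle_mod I"
    unfolding a'_def by (rule socle_mod_conj[OF I a c])
  have A: "a \<in> carrier A" "a' \<in> carrier A" "circ c a \<in> carrier A"
    using a a' c by (auto simp: socle_mod_def circ_closed)
  have "circ a' c = circ (circ c a) \<zero>"
    unfolding a'_def circ_assoc[OF A(3) circ_inv(1)[OF c] c] circ_inv(2)[OF c] ..
  also have "\<dots> = c \<oplus> lam c a"
    using A c by (simp add: circ_def[of _ \<zero>] mult_zero flip: circ_eq_add_lam)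
  finally have "c \<oplus> lam c a = c \<oplus> (a' \<oplus> a' \<otimes> c)"
    using A c by (simp add: circ_def[of a' c] mult_closed a_ac)
  then have "lam c a = a' \<oplus> a' \<otimes> c"
    using A c by (simp add: lam_closed mult_closed)
  moreover have "a' \<otimes> c \<in> I"
    using a' c by (simp add: socle_mod_def)
  ultimately show ?thesis
    using socle_mod_add_ideal[OF I a'] by simp
qed

text \<open>Stability under \<open>lam\<close> turns a circle subgroup into an additive one: sums
  are handled by \<open>add_eq_circ\<close>, and \<open>\<ominus> a\<close> is
  \<open>lam a (circ_inv a)\<close>. Left products are \<open>lam c a \<oplus> \<ominus> a\<close>,
  and right products already lie in \<open>I\<close>.\<close>

lemma brace_ideal_socle_mod:
  assumes I: "brace_ideal I"
  shows "brace_ideal (socle_mod I)"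
proof -
  note D = brace_idealD[OF I]
  have cl: "socle_mod I \<subseteq> carrier A" by (auto simp: socle_mod_def)
  have add: "a \<oplus> b \<in> socle_mod I" if a: "a \<in> socle_mod I" and b: "b \<in> socle_mod I" for a b
  proof -
    have A: "a \<in> carrier A" "b \<in> carrier A" using a b cl by auto
    have "circ a (lam (circ_inv a) b) \<in> socle_mod I"
      using I a A by (intro socle_mod_circ socle_mod_lam b circ_inv) auto
    then show ?thesis using A by (simp add: add_eq_circ)
  qed
  have minus: "\<ominus> a \<in> socle_mod I" if a: "a \<in> socle_mod I" for a
  proof -
    have A: "a \<in> carrier A" using a cl by auto
    have "a \<oplus> lam a (circ_inv a) = \<zero>"
      using A circ_inv by (simp flip: circ_eq_add_lam)
    then have "\<ominus> a = lam a (circ_inv a)"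
      using A by (metis a_comm circ_inv(1) lam_closed minus_equality)
    with socle_mod_lam[OF I socle_mod_circ_inv[OF I a] A] show ?thesis by simp
  qed
  have left: "c \<otimes> a \<in> socle_mod I" if a: "a \<in> socle_mod I" and c: "c \<in> carrier A" for a c
  proof -
    have A: "a \<in> carrier A" using a cl by auto
    have "lam c a \<oplus> \<ominus> a \<in> socle_mod I"
      using add minus socle_mod_lam[OF I a c] a by blast
    then show ?thesis
      using A c by (simp add: lam_def mult_closed a_assoc r_neg)
  qed
  have "subgroup (socle_mod I) (add_monoid A)"
    using cl add minus subset_socle_mod[OF I] D(2)
    by (intro add.subgroupI) (auto simp: a_inv_def)
  with left show ?thesis
    using subset_socle_mod[OF I] by (auto simp: brace_ideal_def socle_mod_def)
qed

section \<open>The series and repeated socles\<close>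

text \<open>One step of the series undoes one passage to the socle. The bound on \<open>m\<close>
  excludes the dummy index 0, where no product is formed.\<close>

lemma right_series_Suc_subset:
  assumes I: "brace_ideal I" and m: "1 \<le> m" and sub: "right_series A m \<subseteq> socle_mod I"
  shows "right_series A (Suc m) \<subseteq> I"
proof -
  have "right_series A (Suc m) = brace_prod A (right_series A m) (carrier A)"
    using m by (cases m) auto
  also have "\<dots> \<subseteq> I"
    unfolding brace_prod_def
    by (rule add.generate_subgroup_incl) (use I sub in \<open>auto simp: brace_ideal_def socle_mod_def\<close>)
  finally show ?thesis .
qed

text \<open>Turns inclusion of a term in \<open>{\<zero>}\<close> into the equality that
  \<open>finite_multipermutation_level\<close> asks for.\<close>

lemma zero_in_right_series: "\<zero> \<in> right_series A m"
proof (cases "m \<le> 1")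
  case True
  then show ?thesis by (cases m) auto
next
  case False
  then obtain k where "m = Suc (Suc k)"
    by (metis One_nat_def le0 not0_implies_Suc not_less_eq_eq)
  then show ?thesis
    using generate.one[of "add_monoid A"] by (simp add: brace_prod_def)
qed

text \<open>Each proper ideal is strictly smaller than its \<open>socle_mod\<close>, so in a finite
  brace repeated socles climb to the whole carrier, and the series descends along them. Induction on
  \<open>card (carrier A) - card I\<close> proves this for all ideals; \<open>I = {\<zero>}\<close>
  is the claim.\<close>

lemma finite_multipermutation_levelI:
  assumes fin: "finite (carrier A)"
    and step: "\<And>I. brace_ideal I \<Longrightarrow> I \<noteq> carrier A \<Longrightarrow> socle_mod I \<noteq> I"
  shows "finite_multipermutation_level A"
proof -
  have "\<exists>m\<ge>1. right_series A m \<subseteq> I" if "brace_ideal I" for I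
    using that
  proof (induction "card (carrier A) - card I" arbitrary: I rule: less_induct)
    case less
    show ?case
    proof (cases "I = carrier A")
      case True
      then show ?thesis by (intro exI[of _ 1]) simp
    next
      case False
      note J = brace_ideal_socle_mod[OF less.prems]
      have sub: "I \<subset> socle_mod I" "socle_mod I \<subseteq> carrier A"
        using step[OF less.prems False] subset_socle_mod[OF less.prems]
        by (auto simp: socle_mod_def)
      have "card I < card (socle_mod I)" "card (socle_mod I) \<le> card (carrier A)"
        using sub fin by (auto intro: psubset_card_mono card_mono finite_subset)
      then obtain m where "1 \<le> m" "right_series A m \<subseteq> socle_mod I"
        using less.hyps[OF _ J] by (meson diff_less_mono2 less_le_trans)
      then show ?thesis
        using right_series_Suc_subset[OF less.prems] by (intro exI[of _ "Suc m"]) auto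
    qed
  qed
  from this[OF brace_ideal_zero] show ?thesis
    using zero_in_right_series unfolding finite_multipermutation_level_def by blast
qed

end

section \<open>Left ideals and their actions on each other\<close>

context left_brace
begin

text \<open>For an additive subgroup this amounts to invariance under every \<open>lam a\<close>,
  which is all that Sylow subgroups provide in general.\<close>

definition left_ideal :: "'a set \<Rightarrow> bool" where
  "left_ideal H \<longleftrightarrow> subgroup H (add_monoid A) \<and> (\<forall>a\<in>carrier A. \<forall>x\<in>H. a \<otimes> x \<in> H)"

lemma left_idealD:
  assumes "left_ideal H"
  shows "x \<in> H \<Longrightarrow> x \<in> carrier A" "\<zero> \<in> H" "x \<in> H \<Longrightarrow> y \<in> H \<Longrightarrow> x \<oplus> y \<in> H"
    "x \<in> H \<Longrightarrow> \<ominus> x \<in> H" "a \<in> carrier A \<Longrightarrow> x \<in> H \<Longrightarrow> a \<otimes> x \<in> H"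
    "a \<in> carrier A \<Longrightarrow> x \<in> H \<Longrightarrow> lam a x \<in> H"
  using assms subgroup.mem_carrier[of H "add_monoid A"] subgroup.one_closed[of H "add_monoid A"]
    subgroup.m_closed[of H "add_monoid A"] subgroup.m_inv_closed[of H "add_monoid A"]
  by (auto simp: left_ideal_def a_inv_def lam_def)

text \<open>Every \<open>lam a\<close> is an additive endomorphism, so it preserves
  \<open>H\<close>, and \<open>a \<otimes> x\<close> is
  \<open>lam a x \<oplus> \<ominus> x\<close>.\<close>

lemma left_ideal_coprime_index:
  assumes H: "subgroup H (add_monoid A)"
    and cop: "coprime (card H) (card (rcosets\<^bsub>add_monoid A\<^esub> H))"
  shows "left_ideal H"
proof -
  have "a \<otimes> x \<in> H" if a: "a \<in> carrier A" and x: "x \<in> H" for a x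
  proof -
    have xA: "x \<in> carrier A"
      using subgroup.mem_carrier[OF H x] by simp
    have "lam a x \<in> H"
      using comm_group.coprime_index_invariant[OF a_comm_group H cop lam_hom[OF a] x] .
    then have "lam a x \<oplus> \<ominus> x \<in> H"
      using subgroup.m_closed[OF H] subgroup.m_inv_closed[OF H x] by (simp add: a_inv_def)
    moreover have "lam a x \<oplus> \<ominus> x = a \<otimes> x"
      using a xA by (simp add: lam_def mult_closed a_assoc r_neg)
    ultimately show ?thesis by simp
  qed
  with H show ?thesis by (simp add: left_ideal_def)
qed

text \<open>Both operations reduce to sums and \<open>lam\<close>: \<open>circ a b\<close> is
  \<open>a \<oplus> lam a b\<close>, and \<open>circ_inv a\<close> is
  \<open>\<ominus> lam (circ_inv a) a\<close>.\<close>

lemma left_ideal_circle_subgroup: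
  assumes H: "left_ideal H"
  shows "subgroup H (circle_group A)"
proof -
  note D = left_idealD[OF H]
  have inv: "circ_inv a \<in> H" if a: "a \<in> H" for a
  proof -
    have A: "a \<in> carrier A" "circ_inv a \<in> carrier A" using a D circ_inv by auto
    have "circ_inv a \<oplus> lam (circ_inv a) a = \<zero>"
      using A circ_inv(2)[OF A(1)] by (simp add: circ_eq_add_lam)
    then have "circ_inv a = \<ominus> lam (circ_inv a) a"
      using A by (metis lam_closed minus_equality)
    also have "\<dots> \<in> H" using D(4,6) A a by blast
    finally show ?thesis .
  qed
  show ?thesis
    using D inv by (intro group.subgroupI[OF group_circle])
      (auto simp: circle_group_simps circ_eq_add_lam)
qed

text \<open>\<open>BijGroup K\<close> consists of functions that are undefined outside
  \<open>K\<close>, hence the restricted form of \<open>lam a\<close>. Its inverse on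
  \<open>K\<close> is given by \<open>lam (circ_inv a)\<close>.\<close>

lemma lam_group_action:
  assumes H: "left_ideal H" and K: "left_ideal K"
  shows "group_action (circle_group A\<lparr>carrier := H\<rparr>) K (\<lambda>a. \<lambda>x\<in>K. lam a x)"
proof -
  note DH = left_idealD[OF H] and DK = left_idealD[OF K]
  have grp: "group (circle_group A\<lparr>carrier := H\<rparr>)"
    by (rule subgroup.subgroup_is_group[OF left_ideal_circle_subgroup[OF H] group_circle])
  have bij: "(\<lambda>x\<in>K. lam a x) \<in> Bij K" if a: "a \<in> carrier A" for a
  proof -
    have "bij_betw (lam a) K K"
      using a DK circ_inv by (intro bij_betwI[of _ _ _ "lam (circ_inv a)"]) (auto simp: lam_circ_inv)
    then show ?thesis
      by (simp add: Bij_def)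
  qed
  have "(\<lambda>a. \<lambda>x\<in>K. lam a x) \<in> hom (circle_group A\<lparr>carrier := H\<rparr>) (BijGroup K)"
  proof (rule homI)
    fix a assume "a \<in> carrier (circle_group A\<lparr>carrier := H\<rparr>)"
    then show "(\<lambda>x\<in>K. lam a x) \<in> carrier (BijGroup K)"
      using bij DH by (simp add: BijGroup_def)
  next
    fix a b assume "a \<in> carrier (circle_group A\<lparr>carrier := H\<rparr>)"
      "b \<in> carrier (circle_group A\<lparr>carrier := H\<rparr>)"
    then have ab: "a \<in> carrier A" "b \<in> carrier A" using DH by auto
    have "(\<lambda>x\<in>K. lam (circ a b) x) = compose K (\<lambda>x\<in>K. lam a x) (\<lambda>x\<in>K. lam b x)"
      using ab DK by (auto simp: compose_def restrict_def lam_circ fun_eq_iff)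
    then show "(\<lambda>x\<in>K. lam (a \<otimes>\<^bsub>circle_group A\<lparr>carrier := H\<rparr>\<^esub> b) x) =
        (\<lambda>x\<in>K. lam a x) \<otimes>\<^bsub>BijGroup K\<^esub> (\<lambda>x\<in>K. lam b x)"
      using ab bij by (simp add: BijGroup_def circle_group_simps)
  qed
  with grp show ?thesis
    by (simp add: group_action_def group_hom_def group_hom_axioms_def group_BijGroup)
qed

text \<open>The circle group on \<open>H\<close> acts on the additive group of \<open>K\<close>
  through \<open>lam\<close>; triviality of this action reads
  \<open>a \<otimes> x \<oplus> x = x\<close>.\<close>

lemma left_ideals_mult_zero:
  assumes H: "left_ideal H" "card H = p ^ m" and K: "left_ideal K" "card K = q ^ \<alpha>"
    and p: "Factorial_Ring.prime p" and q: "Factorial_Ring.prime q" and neq: "p \<noteq> q"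
    and not_dvd: "\<And>t. 1 \<le> t \<Longrightarrow> t \<le> \<alpha> \<Longrightarrow> \<not> p dvd q ^ t - 1"
    and a: "a \<in> H" and x: "x \<in> K"
  shows "a \<otimes> x = \<zero>"
proof -
  note DH = left_idealD[OF H(1)] and DK = left_idealD[OF K(1)]
  interpret act: group_action "circle_group A\<lparr>carrier := H\<rparr>" K "\<lambda>a. \<lambda>x\<in>K. lam a x"
    by (rule lam_group_action[OF H(1) K(1)])
  have "(\<lambda>x\<in>K. lam g x) \<in> hom (add_monoid A\<lparr>carrier := K\<rparr>) (add_monoid A\<lparr>carrier := K\<rparr>)"
    if "g \<in> H" for g
    using that DH DK lam_hom[of g] by (auto simp: hom_def)
  moreover have "group (add_monoid A\<lparr>carrier := K\<rparr>)"
    using K(1) subgroup.subgroup_is_group[OF _ a_group] by (auto simp: left_ideal_def)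
  ultimately have "(\<lambda>x\<in>K. lam a x) x = x"
    using a x H(2) K(2)
    by (intro act.p_group_acts_trivially[OF p _ q neq _ _ _ _ not_dvd,
          where M = "add_monoid A\<lparr>carrier := K\<rparr>"]) (auto simp: order_def)
  then have "a \<otimes> x \<oplus> x = x"
    using x by (simp add: lam_def)
  then show ?thesis
    using a x DH DK mult_closed by (metis add.r_cancel_one')
qed

lemma left_ideal_mult_into_ideal:
  assumes H: "left_ideal H" and fml: "finite_multipermutation_level (A\<lparr>carrier := H\<rparr>)"
    and I: "\<zero> \<in> I" and not_sub: "\<not> H \<subseteq> I"
  obtains a where "a \<in> H" "a \<notin> I" "\<And>b. b \<in> H \<Longrightarrow> a \<otimes> b \<in> I"
proof -
  let ?R = "right_series (A\<lparr>carrier := H\<rparr>)"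
  note D = left_idealD[OF H]
  \<comment> \<open>The recursion starts at index 1: the terms at 0 and 1 are both
    \<open>H\<close>.\<close>
  have R_Suc: "?R (Suc m) = generate (add_monoid A\<lparr>carrier := H\<rparr>) {x \<otimes> y |x y. x \<in> ?R m \<and> y \<in> H}"
    if "1 \<le> m" for m
    using that by (cases m) (auto simp: brace_prod_def)
  have grp: "group (add_monoid A\<lparr>carrier := H\<rparr>)"
    using H subgroup.subgroup_is_group[OF _ a_group] by (auto simp: left_ideal_def)
  have R_sub: "?R m \<subseteq> H" if "1 \<le> m" for m
    using that
  proof (induction m rule: dec_induct)
    case (step m)
    have "{x \<otimes> y |x y. x \<in> ?R m \<and> y \<in> H} \<subseteq> H"
      using step D by auto
    then show ?case
      unfolding R_Suc[OF step.hyps(1)]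
      using group.generate_incl[OF grp] by simp
  qed simp
  obtain n where "1 \<le> n" "?R n \<subseteq> I"
    using fml I by (auto simp: finite_multipermutation_level_def)
  \<comment> \<open>The term at 1 is \<open>H\<close>, outside \<open>I\<close>, and the term at
    \<open>n\<close> is inside, so the series enters \<open>I\<close> at some step between.\<close>
  then have "\<exists>m\<ge>1. \<not> ?R m \<subseteq> I \<and> ?R (Suc m) \<subseteq> I"
  proof (induction n rule: dec_induct)
    case base
    with not_sub show ?case by simp
  qed blast
  then obtain m a where m: "1 \<le> m" "?R (Suc m) \<subseteq> I" and a: "a \<in> ?R m" "a \<notin> I"
    by blast
  show ?thesis
  proof
    fix b assume "b \<in> H"
    then have "a \<otimes> b \<in> ?R (Suc m)"
      unfolding R_Suc[OF m(1)] using a by (intro generate.incl) blast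
    with m show "a \<otimes> b \<in> I" by blast
  qed (use a m R_sub in auto)
qed

text \<open>A consequence of left distributivity, which lets \<open>a \<otimes> b \<in> I\<close> be
  tested on the Sylow subgroups alone.\<close>

lemma left_annihilator_mod_subgroup:
  assumes I: "brace_ideal I" and a: "a \<in> carrier A"
  shows "subgroup {b \<in> carrier A. a \<otimes> b \<in> I} (add_monoid A)"
proof (rule add.subgroupI)
  show "{b \<in> carrier A. a \<otimes> b \<in> I} \<noteq> {}"
    using mult_zero[OF a] brace_idealD(2)[OF I] by auto
qed (use a brace_idealD[OF I] in \<open>auto simp: left_distrib mult_minus simp flip: a_inv_def\<close>)

end

section \<open>Sylow subgroups and prime multiplicities\<close>

text \<open>A prime dividing the index of \<open>J\<close> would, together with the Sylow subgroup
  inside \<open>J\<close>, give a power dividing the group order beyond its multiplicity.\<close>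

lemma (in group) subgroup_containing_sylows:
  assumes fin: "finite (carrier G)" and J: "subgroup J G"
    and sylow: "\<And>p. Factorial_Ring.prime p \<Longrightarrow> p dvd order G \<Longrightarrow> \<exists>H\<subseteq>J. sylow_subgroup p H G"
  shows "J = carrier G"
proof -
  interpret J: subgroup J G by (rule J)
  have eq: "card (rcosets J) * card J = order G"
    by (rule lagrange[OF J])
  have pos: "order G > 0"
    using fin order_gt_0_iff_finite by blast
  have "card (rcosets J) = 1"
  proof (rule ccontr)
    assume "card (rcosets J) \<noteq> 1"
    then obtain p where p: "Factorial_Ring.prime p" "p dvd card (rcosets J)"
      using prime_factor_nat by blast
    then have "p dvd order G"
      using eq by (metis dvd_mult2)
    then obtain H where H: "H \<subseteq> J" "subgroup H G" "card H = p ^ multiplicity p (order G)"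
      using sylow[OF p(1)] by (auto simp: sylow_subgroup_def)
    have "subgroup H (G\<lparr>carrier := J\<rparr>)"
      using H J subgroup_incl by blast
    then have "card H dvd card J"
      using group.lagrange[OF J.subgroup_is_group[OF group_axioms]]
      by (metis dvd_triv_right order_def partial_object.select_convs(1)
          partial_object.update_convs(1) partial_object.surjective)
    then have "p ^ Suc (multiplicity p (order G)) dvd order G"
      using p(2) H(3) eq by (metis mult_dvd_mono power_Suc)
    then show False
      using p(1) pos by (metis Suc_n_not_le_n multiplicity_geI not_prime_unit order_less_irrefl)
  qed
  then have "card J = card (carrier G)"
    using eq by (simp add: order_def)
  then show ?thesis
    using fin J.subset by (simp add: card_subset_eq)
qed

lemma multiplicity_prod_prime_powers:
  fixes p \<alpha> :: "'i \<Rightarrow> nat"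
  assumes fin: "finite S" and i: "i \<in> S"
    and primes: "\<And>j. j \<in> S \<Longrightarrow> Factorial_Ring.prime (p j)" and inj: "inj_on p S"
  shows "multiplicity (p i) (\<Prod>j\<in>S. p j ^ \<alpha> j) = \<alpha> i"
proof -
  have "multiplicity (p i) (\<Prod>j\<in>S. p j ^ \<alpha> j) = (\<Sum>j\<in>S. multiplicity (p i) (p j ^ \<alpha> j))"
    using assms by (intro prime_elem_multiplicity_prod_distrib) (auto simp: image_iff prime_gt_0_nat)
  also have "\<dots> = (\<Sum>j\<in>S. if j = i then \<alpha> j else 0)"
    using assms
    by (intro sum.cong) (auto simp: multiplicity_distinct_prime_power inj_on_eq_iff
        prime_elem_multiplicity_power_distrib)
  finally show ?thesis
    using fin i by simp
qed

section \<open>Nonzero socles from the ordering of the primes\<close>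

theorem corollary8:
  fixes A :: "('a, 'm) ring_scheme"
    and n :: nat
    and p \<alpha> :: "nat \<Rightarrow> nat"
  assumes brace: "left_brace A"
    and primes: "\<And>i. i \<in> {1..n} \<Longrightarrow> Factorial_Ring.prime (p i)"
    and distinct_primes: "inj_on p {1..n}"
    and exponents_pos: "\<And>i. i \<in> {1..n} \<Longrightarrow> \<alpha> i > 0"
    and cardinality: "card (carrier A) = (\<Prod>i = 1..n. p i ^ \<alpha> i)"
    and not_dvd: "\<And>i k t. \<lbrakk>i \<in> {1..n}; k \<in> {1..n}; k < i; 1 \<le> t; t \<le> \<alpha> k\<rbrakk>
                    \<Longrightarrow> \<not> p i dvd p k ^ t - 1"
    and sylow_level: "\<And>q H. sylow_subgroup q H (add_monoid A)
                    \<Longrightarrow> finite_multipermutation_level (A\<lparr>carrier := H\<rparr>)"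
  shows "finite_multipermutation_level A"
proof -
  interpret left_brace A by (rule brace)
  let ?G = "add_monoid A"
  have card_G: "order ?G = (\<Prod>i = 1..n. p i ^ \<alpha> i)"
    using cardinality by (simp add: order_def)
  have pos: "order ?G > 0"
    unfolding card_G using primes by (auto intro!: prod_pos prime_gt_0_nat)
  then have fin: "finite (carrier A)"
    using a_group by (simp add: order_def card_gt_0_iff)
  have mult: "multiplicity (p i) (order ?G) = \<alpha> i" if "i \<in> {1..n}" for i
    unfolding card_G using that primes distinct_primes
    by (intro multiplicity_prod_prime_powers) auto
  have "\<exists>H. sylow_subgroup (p i) H ?G" if i: "i \<in> {1..n}" for i
  proof -
    have "p i ^ \<alpha> i dvd order ?G"
      using multiplicity_dvd[of "p i" "order ?G"] mult[OF i] by simp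
    then obtain k where "order ?G = p i ^ \<alpha> i * k" ..
    then show ?thesis
      using sylow_thm[OF primes[OF i] a_group] fin mult[OF i] primes[OF i]
      by (auto simp: sylow_subgroup_def)
  qed
  then obtain H where H: "\<And>i. i \<in> {1..n} \<Longrightarrow> sylow_subgroup (p i) (H i) ?G"
    by metis
  have card_H: "card (H i) = p i ^ \<alpha> i" if "i \<in> {1..n}" for i
    using H[OF that] mult[OF that] by (simp add: sylow_subgroup_def)
  have left: "left_ideal (H i)" if i: "i \<in> {1..n}" for i
  proof (rule left_ideal_coprime_index)
    show sub: "subgroup (H i) ?G"
      using H[OF i] by (simp add: sylow_subgroup_def)
    let ?r = "card (rcosets\<^bsub>?G\<^esub> H i)"
    have eq: "?r * p i ^ \<alpha> i = order ?G"
      using group.lagrange[OF a_group sub] card_H[OF i] by simp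
    \<comment> \<open>The order of \<open>H i\<close> already absorbs the full multiplicity
      \<open>\<alpha> i\<close> of \<open>p i\<close>.\<close>
    have "\<not> p i dvd ?r"
    proof
      assume "p i dvd ?r"
      then have "p i ^ Suc (\<alpha> i) dvd order ?G"
        using eq by (metis mult_dvd_mono dvd_refl power_Suc)
      then have "Suc (\<alpha> i) \<le> \<alpha> i"
        using mult[OF i] pos primes[OF i]
        by (metis multiplicity_geI not_prime_unit order_less_irrefl)
      then show False by simp
    qed
    then show "coprime (card (H i)) ?r"
      using primes[OF i] card_H[OF i] by (simp add: prime_imp_coprime)
  qed
  \<comment> \<open>Only the primes \<open>p i\<close> divide the order, so one chosen Sylow
    subgroup for each \<open>i\<close> is enough to generate the additive group.\<close>
  have cover: "J = carrier A" if J: "subgroup J ?G" "\<And>i. i \<in> {1..n} \<Longrightarrow> H i \<subseteq> J" for J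
  proof -
    have "\<exists>K\<subseteq>J. sylow_subgroup q K ?G" if q: "Factorial_Ring.prime q" "q dvd order ?G" for q
    proof -
      obtain i where i: "i \<in> {1..n}" "q dvd p i ^ \<alpha> i"
        using q unfolding card_G by (auto simp: prime_dvd_prod_iff)
      then have "q = p i"
        using q primes[OF i(1)] by (meson prime_dvd_power primes_dvd_imp_eq)
      then show ?thesis
        using H[OF i(1)] J(2)[OF i(1)] by blast
    qed
    then show ?thesis
      using group.subgroup_containing_sylows[OF a_group _ J(1)] fin by simp
  qed
  show ?thesis
  proof (rule finite_multipermutation_levelI[OF fin])
    fix I assume I: "brace_ideal I" and ne: "I \<noteq> carrier A"
    note D = brace_idealD[OF I]
    let ?S = "{i \<in> {1..n}. \<not> H i \<subseteq> I}"
    \<comment> \<open>If \<open>I\<close> contained every \<open>H i\<close>, then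
      \<open>cover\<close> would make it the whole carrier.\<close>
    have "?S \<noteq> {}"
      using cover[of I] ne I by (auto simp: brace_ideal_def)
    define i where "i = Max ?S"
    have "i \<in> ?S"
      unfolding i_def using \<open>?S \<noteq> {}\<close> by (intro Max_in) auto
    then have i: "i \<in> {1..n}" "\<not> H i \<subseteq> I" by auto
    have above: "H k \<subseteq> I" if k: "k \<in> {1..n}" "i < k" for k
    proof (rule ccontr)
      assume "\<not> H k \<subseteq> I"
      then have "k \<le> i"
        unfolding i_def using k by (intro Max_ge) auto
      with k show False by simp
    qed
    obtain a where a: "a \<in> H i" "a \<notin> I" "\<And>b. b \<in> H i \<Longrightarrow> a \<otimes>\<^bsub>A\<^esub> b \<in> I"
      using left_ideal_mult_into_ideal[OF left[OF i(1)] sylow_level[OF H[OF i(1)]] D(2) i(2)] by blast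
    have aA: "a \<in> carrier A"
      using left_idealD(1)[OF left[OF i(1)] a(1)] .
    let ?J = "{b \<in> carrier A. a \<otimes>\<^bsub>A\<^esub> b \<in> I}"
    have "H k \<subseteq> ?J" if k: "k \<in> {1..n}" for k
    proof
      fix b assume b: "b \<in> H k"
      consider "k < i" | "k = i" | "i < k" by linarith
      then have "a \<otimes>\<^bsub>A\<^esub> b \<in> I"
      proof cases
        case 1
        have "p i \<noteq> p k"
          using 1 i(1) k distinct_primes by (metis inj_onD less_irrefl)
        then have "a \<otimes>\<^bsub>A\<^esub> b = \<zero>\<^bsub>A\<^esub>"
          using left_ideals_mult_zero[OF left[OF i(1)] card_H[OF i(1)] left[OF k] card_H[OF k]
              primes[OF i(1)] primes[OF k] _ not_dvd[OF i(1) k 1] a(1) b] by blast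
        with D(2) show ?thesis by simp
      next
        case 2
        with a b show ?thesis by blast
      next
        case 3
        with above[OF k] b aA D(5) show ?thesis by blast
      qed
      with left_idealD(1)[OF left[OF k] b] show "b \<in> ?J" by simp
    qed
    \<comment> \<open>\<open>?J\<close> is an additive subgroup containing every \<open>H k\<close>,
      so the products with single Sylow subgroups control all of
      \<open>a \<otimes> b\<close>.\<close>
    then have "?J = carrier A"
      by (intro cover left_annihilator_mod_subgroup[OF I aA])
    then have "a \<in> socle_mod I"
      using aA by (auto simp: socle_mod_def)
    with a(2) show "socle_mod I \<noteq> I" by blast
  qed
qed

end
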